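(* Let $X\subseteq\mathbb{Z}^2\setminus\{O\}$ be a step set, let $\mathcal{C}$ be a submonoid of $\mathbb{Z}^2$, and let $Y\subseteq X$ be the set of $(X,\mathcal{C})$-admissible steps. If $Y$ is finite, then the following are equivalent: (i) $(X,\mathcal{C})$ has the Finite Paths Property (FPP); (ii) $O\notin\operatorname{Conv}(Y)$; (iii) $Y$ satisfies the Line Condition (LC).
   Context: Write $O=(0,0)$. A step set is any (finite or infinite) subset $X$ of $\mathbb{Z}^2\setminus\{O\}$. $\mathcal{F}_X$ is the free monoid on $X$ (all finite words over $X$, including the empty word), with $\ell(w)$ the length of $w$; for $w=A_1\cdots A_k\in\mathcal{F}_X$ put $\alpha_X(w)=A_1+\cdots+A_k$ and, for $0\le m\le k$, $\sigma_m(w)=A_1\cdots A_m$. For a submonoid $\mathcal{C}$ of $\mathbb{Z}^2$, define $\mathcal{F}_X^{\mathcal{C}}=\{w\in\mathcal{F}_X:\alpha_X(\sigma_m(w))\in\mathcal{C}\text{ for all }0\le m\le\ell(w)\}$ and $\mathcal{A}_X^{\mathcal{C}}=\alpha_X(\mathcal{F}_X^{\mathcal{C}})$. For $A\in\mathbb{Z}^2$, $\pi_X^{\mathcal{C}}(A)$ is the (possibly infinite) number of $w\in\mathcal{F}_X^{\mathcal{C}}$ with $\alpha_X(w)=A$. $(X,\mathcal{C})$ has the FPP if $\pi_X^{\mathcal{C}}(A)<\infty$ for all $A\in\mathcal{A}_X^{\mathcal{C}}$. A step $A\in X$ is $(X,\mathcal{C})$-admissible if there exist words $u,v\in\mathcal{F}_X$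 such that $uAv\in\mathcal{F}_X^{\mathcal{C}}$. A step set satisfies the LC if it is contained in an open half-plane of $\mathbb{R}^2$ bounded by a line through $O$. $\operatorname{Conv}$ denotes convex hull in $\mathbb{R}^2$. *)

theory Defs
  imports "HOL-Analysis.Analysis" "HOL-Library.Extended_Nat"
begin

type_synonym point = "int \<times> int"

definition step_set :: "point set \<Rightarrow> bool" where
  "step_set X \<longleftrightarrow> (0, 0) \<notin> X"

definition submonoid_Z2 :: "point set \<Rightarrow> bool" where
  "submonoid_Z2 C \<longleftrightarrow> (0, 0) \<in> C \<and> (\<forall>A\<in>C. \<forall>B\<in>C. A + B \<in> C)"

text \<open>The free monoid on X is \<open>lists X\<close>, the endpoint of a word is its \<open>sum_list\<close>,
  and its prefix of length m is \<open>take m w\<close>.\<close>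

definition constrained_words :: "point set \<Rightarrow> point set \<Rightarrow> point list set" where
  "constrained_words X C =
     {w \<in> lists X. \<forall>m\<le>length w. sum_list (take m w) \<in> C}"

definition reachable :: "point set \<Rightarrow> point set \<Rightarrow> point set" where
  "reachable X C = sum_list ` constrained_words X C"

definition num_paths :: "point set \<Rightarrow> point set \<Rightarrow> point \<Rightarrow> enat" where
  "num_paths X C A =
     (let P = {w \<in> constrained_words X C. sum_list w = A}
      in if finite P then enat (card P) else \<infinity>)"

definition finite_paths_property :: "point set \<Rightarrow> point set \<Rightarrow> bool" where
  "finite_paths_property X C \<longleftrightarrow> (\<forall>A\<in>reachable X C. num_paths X C A < \<infinity>)"

definition admissible_steps :: "point set \<Rightarrow> point set \<Rightarrow> point set" where
  "admissible_steps X C =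
     {A \<in> X. \<exists>u\<in>lists X. \<exists>v\<in>lists X. u @ [A] @ v \<in> constrained_words X C}"

definition to_plane :: "point \<Rightarrow> real \<times> real" where
  "to_plane A = (real_of_int (fst A), real_of_int (snd A))"

text \<open>An open half-plane bounded by a line through the origin is given by a nonzero
  normal vector pointing into it.\<close>

definition line_condition :: "point set \<Rightarrow> bool" where
  "line_condition X \<longleftrightarrow>
     (\<exists>n::real \<times> real. n \<noteq> 0 \<and> to_plane ` X \<subseteq> {p. n \<bullet> p > 0})"

end

(* If the admissible steps lie in an open half-plane, the height of an endpoint above the bounding
   line bounds the length of every path ending there. Conversely, if the origin is in the convex
   hull, simultaneous Dirichlet approximation turns the real convex relation into a relation with
   natural coefficients, i.e. a nonempty closed word L over Y. Concatenating admissible prefixes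
   gives a word W that moves far enough inside C for W L^k to be constrained for every k. *)

theory Submission
  imports Defs
begin

section \<open>Simultaneous Diophantine approximation\<close>

text \<open>Transports simultaneous approximation from an initial segment of the naturals along a
  bijection, so that steps can serve as indices. The denominator \<open>q\<close> is common to all
  of them.\<close>

lemma Dirichlet_approx_finite:
  fixes \<theta> :: "'a \<Rightarrow> real" and N :: nat
  assumes "finite S" "N > 0"
  obtains q :: int and p :: "'a \<Rightarrow> int"
  where "0 < q" "\<And>x. x \<in> S \<Longrightarrow> \<bar>of_int q * \<theta> x - of_int (p x)\<bar> < 1 / N"
proof -
  obtain h where h: "bij_betw h {0..<card S} S"
    using ex_bij_betw_nat_finite[OF \<open>finite S\<close>] by blast
  obtain q p where "0 < q"
    and p: "\<And>i. i < card S \<Longrightarrow> \<bar>of_int q * \<theta> (h i) - of_int (p i)\<bar> < 1 / N"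
    using Dirichlet_approx_simult[OF \<open>N > 0\<close>, of "card S" "\<lambda>i. \<theta> (h i)"] by metis
  define g where "g = inv_into {0..<card S} h"
  have "\<bar>of_int q * \<theta> x - of_int (p (g x))\<bar> < 1 / N" if "x \<in> S" for x
  proof -
    have "g x < card S" "h (g x) = x"
      using h that bij_betw_inv_into_right[OF h] bij_betwE[OF bij_betw_inv_into[OF h]]
      by (auto simp: g_def)
    then show ?thesis using p[of "g x"] by simp
  qed
  with \<open>0 < q\<close> that[of q "p \<circ> g"] show thesis by simp
qed

text \<open>Subtracting \<open>q\<close> times the vanishing real relation leaves only the
  approximation errors weighted by \<open>f\<close>. Their total is below 1 in absolute value, and
  an integer that small is 0.\<close>

lemma integer_sum_eq_0_of_approx:
  fixes f p :: "'a \<Rightarrow> int" and \<theta> :: "'a \<Rightarrow> real"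
  assumes "(\<Sum>x\<in>S. \<theta> x * of_int (f x)) = 0"
    and "\<And>x. x \<in> S \<Longrightarrow> \<bar>of_int q * \<theta> x - of_int (p x)\<bar> < 1 / real N"
    and "(\<Sum>x\<in>S. \<bar>f x\<bar>) < int N"
  shows "(\<Sum>x\<in>S. p x * f x) = 0"
proof -
  have "N > 0" using assms(3) sum_nonneg[of S "\<lambda>x. \<bar>f x\<bar>"] by linarith
  have "real_of_int (\<Sum>x\<in>S. p x * f x) = (\<Sum>x\<in>S. (of_int (p x) - of_int q * \<theta> x) * of_int (f x))"
  proof -
    have "(\<Sum>x\<in>S. (of_int q * \<theta> x) * of_int (f x)) = of_int q * (\<Sum>x\<in>S. \<theta> x * of_int (f x))"
      by (simp add: sum_distrib_left mult.assoc)
    then show ?thesis using assms(1) by (simp add: left_diff_distrib sum_subtractf)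
  qed
  also have "\<bar>\<dots>\<bar> \<le> (\<Sum>x\<in>S. \<bar>(of_int (p x) - of_int q * \<theta> x) * of_int (f x)\<bar>)"
    by (rule sum_abs)
  also have "\<dots> \<le> (\<Sum>x\<in>S. 1 / real N * of_int \<bar>f x\<bar>)"
    unfolding abs_mult using assms(2)
    by (intro sum_mono mult_mono) (auto simp: abs_minus_commute less_imp_le)
  also have "\<dots> = of_int (\<Sum>x\<in>S. \<bar>f x\<bar>) / real N"
    by (simp add: sum_divide_distrib)
  also have "\<dots> < 1"
  proof -
    have "real_of_int (\<Sum>x\<in>S. \<bar>f x\<bar>) < real N"
      using assms(3) by (metis of_int_less_iff of_int_of_nat_eq)
    then show ?thesis using \<open>N > 0\<close> by (simp only: divide_less_eq_1_pos of_nat_0_less_iff)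
  qed
  finally show ?thesis by linarith
qed

section \<open>From convex relations to closed words\<close>

lemma fst_sum_list: "fst (sum_list xs) = sum_list (map fst xs)"
  by (induction xs) auto

lemma snd_sum_list: "snd (sum_list xs) = sum_list (map snd xs)"
  by (induction xs) auto

text \<open>Realises integer coefficients as a word. Quantifying over \<open>f\<close> inside the
  existential lets one word serve both coordinates.\<close>

lemma list_with_multiplicities:
  fixes c :: "'a \<Rightarrow> int"
  assumes "finite S" "\<And>x. x \<in> S \<Longrightarrow> c x \<ge> 0"
  shows "\<exists>L. set L \<subseteq> S \<and> int (length L) = sum c S
           \<and> (\<forall>f :: 'a \<Rightarrow> int. sum_list (map f L) = (\<Sum>x\<in>S. c x * f x))"
  using assms
proof (induction S rule: finite_induct)
  case empty
  show ?case by simp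
next
  case (insert x S)
  obtain L where L: "set L \<subseteq> S" "int (length L) = sum c S"
    "\<forall>f :: 'a \<Rightarrow> int. sum_list (map f L) = (\<Sum>x\<in>S. c x * f x)"
    using insert.IH[OF insert.prems[OF insertI2]] by blast
  let ?L = "replicate (nat (c x)) x @ L"
  have "c x \<ge> 0" using insert.prems by blast
  then have "int (length ?L) = sum c (insert x S)"
    "\<forall>f :: 'a \<Rightarrow> int. sum_list (map f ?L) = (\<Sum>x\<in>insert x S. c x * f x)"
    using insert.hyps L by (simp_all add: sum_list_replicate)
  moreover have "set ?L \<subseteq> insert x S" using L(1) by auto
  ultimately show ?case by blast
qed

text \<open>The convex coefficients may be irrational. Close enough approximations with a common
  denominator satisfy the same relation exactly, because the steps are integral; the numerators then
  become multiplicities of letters.\<close>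

lemma zero_in_hull_imp_closed_word:
  assumes "finite Y" "(0, 0) \<in> convex hull (to_plane ` Y)"
  obtains L where "L \<in> lists Y" "L \<noteq> []" "sum_list L = 0"
proof -
  \<comment> \<open>Injectivity allows the coefficients on the image to be indexed by
    \<open>Y\<close> itself.\<close>
  have inj: "inj_on to_plane Y"
    by (auto simp: inj_on_def to_plane_def prod_eq_iff)
  obtain u where u: "\<And>y. y \<in> to_plane ` Y \<Longrightarrow> 0 \<le> u y" "sum u (to_plane ` Y) = 1"
    "(\<Sum>y\<in>to_plane ` Y. u y *\<^sub>R y) = (0, 0)"
    using assms(2) unfolding convex_hull_finite[OF finite_imageI[OF \<open>finite Y\<close>]] by blast
  define \<theta> where "\<theta> = u \<circ> to_plane"
  have nonneg: "\<theta> y \<ge> 0" if "y \<in> Y" for y using u that by (simp add: \<theta>_def)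
  have one: "(\<Sum>y\<in>Y. \<theta> y) = 1"
    using u(2) inj by (simp add: \<theta>_def sum.reindex)
  have zero: "(\<Sum>y\<in>Y. \<theta> y *\<^sub>R to_plane y) = (0, 0)"
    using u(3) inj by (simp add: \<theta>_def sum.reindex)
  have zero_fst: "(\<Sum>y\<in>Y. \<theta> y * of_int (fst y)) = 0"
    using arg_cong[OF zero, of fst] by (simp add: fst_sum to_plane_def)
  have zero_snd: "(\<Sum>y\<in>Y. \<theta> y * of_int (snd y)) = 0"
    using arg_cong[OF zero, of snd] by (simp add: snd_sum to_plane_def)
  \<comment> \<open>\<open>N\<close> exceeds three quantities at once: the two coordinate sums,
    which forces both integer relations to hold exactly, and \<open>card Y\<close>, which keeps the
    numerators from all vanishing.\<close>
  define N where "N = nat ((\<Sum>y\<in>Y. \<bar>fst y\<bar>) + (\<Sum>y\<in>Y. \<bar>snd y\<bar>) + int (card Y) + 1)"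
  have ge: "(\<Sum>y\<in>Y. \<bar>fst y\<bar>) \<ge> 0" "(\<Sum>y\<in>Y. \<bar>snd y\<bar>) \<ge> 0" by (simp_all add: sum_nonneg)
  have N: "(\<Sum>y\<in>Y. \<bar>fst y\<bar>) < int N" "(\<Sum>y\<in>Y. \<bar>snd y\<bar>) < int N" "card Y < N" "N > 0"
    unfolding N_def using ge by linarith+
  obtain q p where "0 < q"
    and p: "\<And>y. y \<in> Y \<Longrightarrow> \<bar>of_int q * \<theta> y - of_int (p y)\<bar> < 1 / N"
    using Dirichlet_approx_finite[OF \<open>finite Y\<close> \<open>N > 0\<close>] by metis
  have p_nonneg: "p y \<ge> 0" if "y \<in> Y" for y
  proof -
    have "of_int q * \<theta> y \<ge> 0" using nonneg[OF that] \<open>0 < q\<close> by simp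
    moreover have "1 / real N \<le> 1" using \<open>N > 0\<close> by simp
    ultimately have "of_int (p y) > (-1 :: real)" using p[OF that] by linarith
    then show ?thesis by linarith
  qed
  \<comment> \<open>The products \<open>q * \<theta> y\<close> add up to \<open>q\<close>, which is
    at least 1, while the rounding loses less than 1 in total.\<close>
  have p_sum: "sum p Y > 0"
  proof -
    have "(\<Sum>y\<in>Y. of_int q * \<theta> y - of_int (p y)) \<le> (\<Sum>y\<in>Y. 1 / real N)"
      using p by (intro sum_mono) (meson abs_ge_self le_less_trans less_imp_le)
    also have "\<dots> < 1" using N by simp
    finally have "of_int q * (\<Sum>y\<in>Y. \<theta> y) - real_of_int (sum p Y) < 1"
      by (simp add: sum_subtractf sum_distrib_left)
    then show ?thesis unfolding one using \<open>0 < q\<close> by linarith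
  qed
  obtain L where L: "set L \<subseteq> Y" "int (length L) = sum p Y"
    "\<forall>f :: point \<Rightarrow> int. sum_list (map f L) = (\<Sum>y\<in>Y. p y * f y)"
    using list_with_multiplicities[of Y p] \<open>finite Y\<close> p_nonneg by blast
  have "sum_list L = 0"
    using integer_sum_eq_0_of_approx[OF zero_fst p N(1)]
      integer_sum_eq_0_of_approx[OF zero_snd p N(2)]
    by (simp add: prod_eq_iff fst_sum_list snd_sum_list L(3))
  moreover have "L \<noteq> []" using L(2) p_sum by auto
  ultimately show thesis using that L(1) by auto
qed

section \<open>Constrained words and admissible steps\<close>

lemma constrained_words_append_iff:
  "w @ v \<in> constrained_words X C \<longleftrightarrow>
     w \<in> constrained_words X C \<and> v \<in> lists X \<and>
     (\<forall>m\<le>length v. sum_list w + sum_list (take m v) \<in> C)" (is "?l \<longleftrightarrow> ?r")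
proof
  assume l: ?l
  have pre: "sum_list (take m (w @ v)) \<in> C" if "m \<le> length w + length v" for m
    using l that by (simp add: constrained_words_def)
  have "sum_list (take m w) \<in> C" if "m \<le> length w" for m
    using pre[of m] that by simp
  moreover have "sum_list w + sum_list (take m v) \<in> C" if "m \<le> length v" for m
    using pre[of "length w + m"] that by simp
  ultimately show ?r using l by (auto simp: constrained_words_def)
next
  assume r: ?r
  have "sum_list (take m (w @ v)) \<in> C" if "m \<le> length w + length v" for m
  proof (cases "m \<le> length w")
    case True
    then show ?thesis using r by (auto simp: constrained_words_def)
  next
    case False
    then have "sum_list w + sum_list (take (m - length w) v) \<in> C" using r that by simp
    then show ?thesis using False by simp
  qed
  then show ?l using r by (auto simp: constrained_words_def)
qed

lemma constrained_words_sum_list: "w \<in> constrained_words X C \<Longrightarrow> sum_list w \<in> C"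
  by (force simp: constrained_words_def)

lemma constrained_words_Nil: "submonoid_Z2 C \<Longrightarrow> [] \<in> constrained_words X C"
  by (simp add: constrained_words_def submonoid_Z2_def zero_prod_def)

lemma set_constrained_word_admissible:
  assumes "w \<in> constrained_words X C"
  shows "set w \<subseteq> admissible_steps X C"
proof
  fix A assume "A \<in> set w"
  then obtain u v where w: "w = u @ [A] @ v" by (metis append_Cons append_Nil split_list)
  have "w \<in> lists X" using assms by (simp add: constrained_words_def)
  with w assms show "A \<in> admissible_steps X C" by (auto simp: admissible_steps_def)
qed

text \<open>Each letter \<open>A\<close> of \<open>L\<close> becomes usable after some prefix
  \<open>u\<close> that stays in \<open>C\<close>. Concatenating these prefixes works because
  translating a path in \<open>C\<close> by a point of \<open>C\<close> keeps it in
  \<open>C\<close>.\<close>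

lemma admissible_word_has_starting_word:
  assumes "submonoid_Z2 C" "L \<in> lists (admissible_steps X C)"
  shows "\<exists>W. W @ L \<in> constrained_words X C"
  using assms(2)
proof (induction L)
  case Nil
  then show ?case using constrained_words_Nil[OF assms(1)] by (metis append_Nil)
next
  case (Cons A L)
  have add: "x + y \<in> C" if "x \<in> C" "y \<in> C" for x y
    using assms(1) that by (auto simp: submonoid_Z2_def)
  obtain W where W: "W @ L \<in> constrained_words X C" using Cons by auto
  obtain u v where "u @ [A] @ v \<in> constrained_words X C"
    using Cons.hyps by (auto simp: admissible_steps_def)
  then have "(u @ [A]) @ v \<in> constrained_words X C" by simp
  then have uA: "u @ [A] \<in> constrained_words X C"
    by (simp only: constrained_words_append_iff[of "u @ [A]" v])
  then have u: "u \<in> constrained_words X C" and "A \<in> X"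
    by (auto simp: constrained_words_append_iff[of u])
  have L: "W \<in> constrained_words X C" "L \<in> lists X"
    "\<And>m. m \<le> length L \<Longrightarrow> sum_list W + sum_list (take m L) \<in> C"
    using W by (auto simp: constrained_words_append_iff)
  have uC: "sum_list u \<in> C" and uAC: "sum_list u + A \<in> C" and WC: "sum_list W \<in> C"
    using constrained_words_sum_list[OF u] constrained_words_sum_list[OF uA]
      constrained_words_sum_list[OF L(1)] by simp_all
  have "sum_list u + sum_list (take m W) \<in> C" if "m \<le> length W" for m
    using add[OF uC] L(1) that by (auto simp: constrained_words_def)
  then have uW: "u @ W \<in> constrained_words X C"
    using u L(1) by (simp add: constrained_words_append_iff[of u]) (simp add: constrained_words_def)
  have "sum_list (u @ W) + sum_list (take m (A # L)) \<in> C" if "m \<le> length (A # L)" for m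
  proof (cases m)
    case 0
    then show ?thesis using add[OF uC WC] by simp
  next
    case (Suc k)
    \<comment> \<open>Commutativity moves \<open>A\<close> from behind \<open>W\<close> to behind
      \<open>u\<close>, which writes the point reached as a sum of two points of
      \<open>C\<close>.\<close>
    then have "(sum_list u + A) + (sum_list W + sum_list (take k L)) \<in> C"
      using add[OF uAC L(3)] that by simp
    then show ?thesis using Suc by (simp add: algebra_simps)
  qed
  then have "(u @ W) @ A # L \<in> constrained_words X C"
    using uW L(2) \<open>A \<in> X\<close> constrained_words_append_iff[of "u @ W" "A # L"] by simp
  then show ?case by blast
qed

text \<open>Every copy of \<open>L\<close> starts from the same point \<open>sum_list W\<close>, so
  it visits the same points as the first copy.\<close>

lemma constrained_words_repeat_closed:
  assumes "W @ L \<in> constrained_words X C" "sum_list L = 0"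
  shows "W @ concat (replicate k L) \<in> constrained_words X C
           \<and> sum_list (W @ concat (replicate k L)) = sum_list W"
proof (induction k)
  case 0
  then show ?case using assms by (simp add: constrained_words_append_iff)
next
  case (Suc k)
  let ?V = "W @ concat (replicate k L)"
  have eq: "W @ concat (replicate (Suc k) L) = ?V @ L"
    by (simp flip: replicate_append_same)
  have "?V @ L \<in> constrained_words X C"
    using Suc assms(1) constrained_words_append_iff[of ?V L] constrained_words_append_iff[of W L] by simp
  then show ?case unfolding eq using Suc assms(2) by simp
qed

section \<open>The implications between the three conditions\<close>

lemma FPP_imp_zero_notin_hull:
  assumes "submonoid_Z2 C" "finite (admissible_steps X C)" "finite_paths_property X C"
  shows "(0, 0) \<notin> convex hull (to_plane ` admissible_steps X C)"
proof
  assume "(0, 0) \<in> convex hull (to_plane ` admissible_steps X C)"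
  then obtain L where L: "L \<in> lists (admissible_steps X C)" "L \<noteq> []" "sum_list L = 0"
    using zero_in_hull_imp_closed_word[OF assms(2)] by metis
  obtain W where W: "W @ L \<in> constrained_words X C"
    using admissible_word_has_starting_word[OF assms(1) L(1)] by blast
  let ?P = "{w \<in> constrained_words X C. sum_list w = sum_list W}"
  let ?w = "\<lambda>k. W @ concat (replicate k L)"
  have "range ?w \<subseteq> ?P"
    using constrained_words_repeat_closed[OF W L(3)] by blast
  moreover have "inj ?w"
  proof (rule injI)
    fix j k assume "?w j = ?w k"
    then have "length (?w j) = length (?w k)" by (rule arg_cong)
    \<comment> \<open>The length is \<open>length W + k * length L\<close>, and \<open>L\<close> is
      nonempty, so it determines \<open>k\<close>.\<close>
    then show "j = k" using L(2) by (simp add: length_concat sum_list_replicate)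
  qed
  ultimately have "infinite ?P"
    using finite_subset range_inj_infinite by blast
  moreover have "sum_list W \<in> reachable X C"
    using W by (auto simp: reachable_def constrained_words_append_iff)
  ultimately show False
    using assms(3) by (auto simp: finite_paths_property_def num_paths_def Let_def)
qed

text \<open>Finiteness makes the hull closed, so it can be strictly separated from the origin, and
  the normal of the separating line is the one required. Conversely, an open half-plane is convex
  and omits the origin.\<close>

lemma zero_notin_hull_iff_line_condition:
  assumes "finite Y"
  shows "(0, 0) \<notin> convex hull (to_plane ` Y) \<longleftrightarrow> line_condition Y"
proof
  assume "(0, 0) \<notin> convex hull (to_plane ` Y)"
  moreover have "closed (convex hull (to_plane ` Y))"
    using assms by (simp add: finite_imp_compact_convex_hull compact_imp_closed)
  ultimately obtain a b where "a \<noteq> 0" "0 < b"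
    and a: "\<And>x. x \<in> convex hull (to_plane ` Y) \<Longrightarrow> a \<bullet> x > b"
    using separating_hyperplane_closed_0[of "convex hull (to_plane ` Y)"]
    by (auto simp: zero_prod_def)
  have "a \<bullet> x > 0" if "x \<in> to_plane ` Y" for x
    using a[OF hull_inc[OF that]] \<open>0 < b\<close> by linarith
  then show "line_condition Y"
    unfolding line_condition_def using \<open>a \<noteq> 0\<close> by blast
next
  assume "line_condition Y"
  then obtain n where "to_plane ` Y \<subseteq> {p. n \<bullet> p > 0}" by (auto simp: line_condition_def)
  then have "convex hull (to_plane ` Y) \<subseteq> {p. n \<bullet> p > 0}"
    by (intro hull_minimal convex_halfspace_gt)
  then show "(0, 0) \<notin> convex hull (to_plane ` Y)"
    by (auto simp flip: zero_prod_def)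
qed

text \<open>Finiteness gives a uniform gain \<open>d\<close> in height per step, so the endpoint
  bounds the length, and only finitely many words over a finite alphabet have bounded
  length.\<close>

lemma line_condition_imp_FPP:
  assumes "finite (admissible_steps X C)" "line_condition (admissible_steps X C)"
  shows "finite_paths_property X C"
proof -
  let ?Y = "admissible_steps X C"
  obtain n where n: "\<And>y. y \<in> ?Y \<Longrightarrow> n \<bullet> to_plane y > 0"
    using assms(2) by (auto simp: line_condition_def)
  obtain d :: real where d: "d > 0" "\<And>y. y \<in> ?Y \<Longrightarrow> n \<bullet> to_plane y \<ge> d"
  proof
    \<comment> \<open>The extra element 1 keeps the minimum meaningful and positive when there are
      no admissible steps.\<close>
    let ?D = "insert 1 ((\<lambda>y. n \<bullet> to_plane y) ` ?Y)"
    show "Min ?D > 0" using assms(1) n by (subst Min_gr_iff) auto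
    show "n \<bullet> to_plane y \<ge> Min ?D" if "y \<in> ?Y" for y
      using assms(1) that by (intro Min_le) auto
  qed
  have height: "d * length w \<le> n \<bullet> to_plane (sum_list w)" if "set w \<subseteq> ?Y" for w
    using that
  proof (induction w)
    case Nil
    then show ?case by (simp add: to_plane_def flip: zero_prod_def)
  next
    case (Cons y w)
    have "to_plane (y + sum_list w) = to_plane y + to_plane (sum_list w)"
      by (simp add: to_plane_def)
    then show ?case using Cons d(2)[of y] by (simp add: inner_add_right algebra_simps)
  qed
  have "finite {w \<in> constrained_words X C. sum_list w = A}" for A
  proof (rule finite_subset)
    show "{w \<in> constrained_words X C. sum_list w = A}
            \<subseteq> {w. set w \<subseteq> ?Y \<and> length w \<le> nat \<lfloor>n \<bullet> to_plane A / d\<rfloor>}"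
    proof (clarify, intro conjI)
      fix w assume w: "w \<in> constrained_words X C" "A = sum_list w"
      show Y: "set w \<subseteq> ?Y" using set_constrained_word_admissible[OF w(1)] .
      have "real (length w) \<le> n \<bullet> to_plane (sum_list w) / d"
        using height[OF Y] d(1) by (simp add: field_simps)
      then show "length w \<le> nat \<lfloor>n \<bullet> to_plane (sum_list w) / d\<rfloor>" by linarith
    qed
    show "finite {w. set w \<subseteq> ?Y \<and> length w \<le> nat \<lfloor>n \<bullet> to_plane A / d\<rfloor>}"
      by (rule finite_lists_length_le[OF assms(1)])
  qed
  then show ?thesis by (simp add: finite_paths_property_def num_paths_def)
qed

theorem theorem3p13:
  fixes X C Y :: "(int \<times> int) set"
  assumes "step_set X"
    and "submonoid_Z2 C"
    and "Y = admissible_steps X C"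
    and "finite Y"
  shows "(finite_paths_property X C \<longleftrightarrow> (0, 0) \<notin> convex hull (to_plane ` Y))
       \<and> ((0, 0) \<notin> convex hull (to_plane ` Y) \<longleftrightarrow> line_condition Y)"
  using assms(2-4) FPP_imp_zero_notin_hull line_condition_imp_FPP
    zero_notin_hull_iff_line_condition by blast

end
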